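(* No prime number is expressible as a sum of successive odd positive numbers, and no prime number is expressible as a sum of successive even positive numbers.
   Context: A sum of successive odd (respectively even) positive numbers is a sum $a+(a+2)+(a+4)+\cdots+(a+2(r-1))$ with $r\ge 2$ terms, where $a$ is an odd (respectively even) positive integer. *)

theory Defs
  imports "HOL-Computational_Algebra.Primes"
begin

definition sum_of_successive_odds :: "nat \<Rightarrow> bool" where
  "sum_of_successive_odds n \<longleftrightarrow>
     (\<exists>a r :: nat. odd a \<and> a > 0 \<and> r \<ge> 2 \<and> n = (\<Sum>i<r. a + 2 * i))"

definition sum_of_successive_evens :: "nat \<Rightarrow> bool" where
  "sum_of_successive_evens n \<longleftrightarrow>
     (\<exists>a r :: nat. even a \<and> a > 0 \<and> r \<ge> 2 \<and> n = (\<Sum>i<r. a + 2 * i))"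

end

theory Submission
  imports Defs
begin

text \<open>
  An arithmetic progression with difference \<open>2\<close> sums to the number of its terms times the mean
  of its first and last term. Because the difference is \<open>2\<close>, that mean is an integer, \<open>a + (r - 1)\<close>
  for \<open>r\<close> terms starting at \<open>a\<close>, so the sum is a product of two natural numbers. With
  \<open>r \<ge> 2\<close> and \<open>a > 0\<close> both factors are at least \<open>2\<close>, and the sum is composite. The
  same factorization settles odd and even summands.
\<close>

text \<open>Counting the terms as \<open>Suc k\<close> keeps truncated subtraction out of the formula.\<close>

lemma sum_progression_diff_2:
  fixes a k :: nat
  shows "(\<Sum>i<Suc k. a + 2 * i) = Suc k * (a + k)"
  by (induction k) (simp_all add: algebra_simps)

lemma not_prime_sum_progression_diff_2:
  fixes a r :: nat
  assumes "a > 0" and "r \<ge> 2"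
  shows "\<not> prime (\<Sum>i<r. a + 2 * i)"
proof -
  obtain k where r: "r = Suc k" and "k \<ge> 1"
    using \<open>r \<ge> 2\<close> by (cases r) auto
  have "Suc k \<noteq> 1" and "a + k \<noteq> 1"
    using \<open>a > 0\<close> \<open>k \<ge> 1\<close> by auto
  then have "\<not> prime (Suc k * (a + k))"
    using prime_product by blast
  then show ?thesis
    unfolding r sum_progression_diff_2 .
qed

theorem theorem1:
  shows "(\<nexists>p :: nat. prime p \<and> sum_of_successive_odds p) \<and>
         (\<nexists>p :: nat. prime p \<and> sum_of_successive_evens p)"
  using not_prime_sum_progression_diff_2
  unfolding sum_of_successive_odds_def sum_of_successive_evens_def by blast

end
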